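(* Let $X_1,X_2,\dots$ be a sequence of (not necessarily independent) real random variables defined on a common probability space, and suppose that for constants $A>0$, $a>0$, $b\ge 0$ and $\gamma\in(0,2)$ the inequality $$\mathbf{P}\{|S(m+1,m+n)|>t\}\le A\exp\left\{-\frac{a t^{2}}{n+b t^{\gamma}}\right\}$$ holds for all integers $m\ge 0$, $n\ge 1$ and all real $t\ge 0$. Then, with probability $1$, $$\limsup_{n\to\infty}\frac{|S(1,n)|}{\sqrt{n\log\log n}}\le\frac{1}{\sqrt{a}}.$$
   Context: For a sequence of random variables $X_1,X_2,\dots$ and integers $1\le k\le l<\infty$, the partial sums are $S(k,l)=\sum_{i=k}^{l}X_i$. Here $\log$ denotes the natural logarithm. *)

theory Defs
  imports "HOL-Probability.Probability"
begin

definition partial_sum :: "(nat \<Rightarrow> 'a \<Rightarrow> real) \<Rightarrow> nat \<Rightarrow> nat \<Rightarrow> 'a \<Rightarrow> real" where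
  "partial_sum X k l \<omega> = (\<Sum>i=k..l. X i \<omega>)"

end

theory Submission
  imports Defs "HOL-Real_Asymp.Real_Asymp"
begin

text \<open>
  Split \<open>[2 ^ p, 2 ^ (p + 1))\<close> into \<open>2 ^ s\<close> equal blocks, with \<open>s\<close> fixed. At the finitely many grid
  points the tail bound at level \<open>c * sqrt (n * ln p)\<close> is about \<open>p powr - (a * c\<^sup>2)\<close>, because
  \<open>\<gamma> < 2\<close> makes the term \<open>b * t powr \<gamma>\<close> negligible against \<open>n\<close>; this is summable in \<open>p\<close> as soon as
  \<open>c > 1 / sqrt a\<close>. Inside a block, the binary expansion of \<open>n\<close> writes \<open>S n\<close> minus its value at
  the grid point as a sum of increments over dyadic intervals of length \<open>2 ^ (p - r)\<close>, \<open>s < r \<le> p\<close>.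
  Increments at level \<open>r\<close> are compared with \<open>(3/4) ^ r * sqrt (2 ^ p * ln p)\<close>. The ratio lies
  between \<open>1 / sqrt 2\<close> and \<open>1\<close>: it is small enough that these thresholds sum to a small multiple of
  \<open>sqrt (2 ^ p * ln p)\<close> when \<open>s\<close> is large, and large enough that the exponent in the tail bound
  beats the number \<open>2 ^ r\<close> of intervals, even at the finest level, where \<open>b * t powr \<gamma>\<close> dominates.
  Borel--Cantelli then controls all \<open>n\<close> at once, since \<open>ln p\<close> is asymptotic to \<open>ln (ln n)\<close>.
\<close>

section \<open>Dyadic chaining inside a block\<close>

text \<open>Let \<open>g r\<close> keep the leading \<open>r\<close> of the \<open>p\<close> binary
  digits of \<open>k\<close> and replace the others by zeros. Then \<open>g s\<close> is the grid
  point, \<open>g p\<close> is \<open>k\<close>, and passing from \<open>g r\<close> to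
  \<open>g (Suc r)\<close> either changes nothing or crosses one aligned interval of length
  \<open>2 ^ (p - Suc r)\<close>. Telescoping uses at most one increment per level.\<close>

lemma dyadic_chain:
  fixes f :: "nat \<Rightarrow> real" and t :: "nat \<Rightarrow> real"
  assumes increment: "\<And>r j. s < r \<Longrightarrow> r \<le> p \<Longrightarrow> j < 2 ^ r \<Longrightarrow>
      \<bar>f (j * 2 ^ (p - r) + 2 ^ (p - r)) - f (j * 2 ^ (p - r))\<bar> \<le> t r"
    and "s \<le> p" "k < 2 ^ p"
  obtains i where "i < 2 ^ s" "i * 2 ^ (p - s) \<le> k"
    "\<bar>f k - f (i * 2 ^ (p - s))\<bar> \<le> (\<Sum>r\<in>{s<..p}. t r)"
proof -
  define g where "g r = k div 2 ^ (p - r) * 2 ^ (p - r)" for r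
  have digits: "k div 2 ^ (p - r) < 2 ^ r" if "r \<le> p" for r
  proof -
    have "(2::nat) ^ p = 2 ^ r * 2 ^ (p - r)"
      using that by (simp flip: power_add)
    then show ?thesis
      using \<open>k < 2 ^ p\<close> by (simp add: less_mult_imp_div_less)
  qed
  have "\<bar>f (g r) - f (g s)\<bar> \<le> (\<Sum>r\<in>{s<..r}. t r)" if "s \<le> r" "r \<le> p" for r
    using that
  proof (induction r rule: dec_induct)
    case base
    then show ?case by simp
  next
    case (step r)
    define w where "w = k div 2 ^ (p - Suc r)"
    define e where "e = (2::nat) ^ (p - Suc r)"
    have w: "w < 2 ^ Suc r"
      unfolding w_def using digits step.prems by blast
    have half: "(2::nat) ^ (p - r) = e * 2"
      using step.prems unfolding e_def by (metis Suc_diff_le diff_Suc_Suc power_Suc2)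
    then have "k div 2 ^ (p - r) = w div 2"
      unfolding w_def e_def by (simp add: div_mult2_eq)
    then have gr: "g r = w div 2 * 2 * e"
      unfolding g_def half by simp
    have gSuc: "g (Suc r) = w * e"
      by (simp add: g_def w_def e_def)
    have "\<bar>f (g (Suc r)) - f (g r)\<bar> \<le> t (Suc r)"
    proof (cases "even w")
      case True
      \<comment> \<open>The new digit is 0, so the point does not move. The threshold is nonnegative
        because it dominates the absolute value of the increment at \<open>j = 0\<close>.\<close>
      have "0 \<le> t (Suc r)"
        using increment[of "Suc r" 0] step by (smt (verit) less_Suc_eq_le zero_less_power pos2)
      with True show ?thesis by (simp add: gr gSuc)
    next
      case False
      then have *: "w = w div 2 * 2 + 1" by presburger
      then have "w * e = (w div 2 * 2) * e + e"
        by (metis add_mult_distrib mult_1)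
      moreover have "w div 2 * 2 < 2 ^ Suc r" using w by linarith
      ultimately show ?thesis
        using increment[of "Suc r" "w div 2 * 2"] step by (simp add: gr gSuc e_def)
    qed
    moreover have "{s<..Suc r} = insert (Suc r) {s<..r}" using step by auto
    ultimately show ?case using step by simp
  qed
  from this[of p] \<open>s \<le> p\<close> have "\<bar>f k - f (g s)\<bar> \<le> (\<Sum>r\<in>{s<..p}. t r)"
    by (simp add: g_def)
  moreover have "g s \<le> k" by (simp add: g_def)
  ultimately show ?thesis
    using that[of "k div 2 ^ (p - s)"] digits[OF \<open>s \<le> p\<close>] unfolding g_def by blast
qed

section \<open>Lower bounds for the exponent in the tail inequality\<close>

text \<open>Clearing the denominator allows its two terms \<open>n\<close> and
  \<open>b * t powr \<gamma>\<close> to be estimated separately.\<close>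

lemma le_exponentI:
  fixes a b \<gamma> t n u :: real
  assumes "n > 0" "b \<ge> 0" "u * n + u * (b * t powr \<gamma>) \<le> a * t\<^sup>2"
  shows "u \<le> a * t\<^sup>2 / (n + b * t powr \<gamma>)"
proof -
  have "n + b * t powr \<gamma> > 0" using assms by (simp add: add_pos_nonneg)
  then show ?thesis using assms by (simp add: pos_le_divide_eq algebra_simps)
qed

text \<open>Splits off the factor \<open>t powr \<gamma>\<close> that also occurs in the denominator
  of the exponent. For \<gamma> < 2 what remains is a positive power of \<open>t\<^sup>2\<close>,
  which outgrows logarithms.\<close>

lemma powr_split_square:
  fixes t \<gamma> :: real
  assumes "t > 0"
  shows "t\<^sup>2 = t powr \<gamma> * (t\<^sup>2) powr (1 - \<gamma> / 2)"
proof -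
  have "t\<^sup>2 = t powr 2" using assms by simp
  then have "(t\<^sup>2) powr (1 - \<gamma> / 2) = t powr (2 - \<gamma>)"
    by (simp add: powr_powr right_diff_distrib)
  with \<open>t\<^sup>2 = t powr 2\<close> show ?thesis by (simp flip: powr_add)
qed

text \<open>
  The summand \<open>real r\<close> compensates the \<open>2 ^ r\<close> intervals of level \<open>r\<close>; the factor \<open>3\<close> keeps the bound
  summable in \<open>p\<close> after adding up at most \<open>p\<close> levels.
\<close>

lemma eventually_exponent_levels:
  fixes a b \<gamma> :: real
  assumes "a > 0" "b \<ge> 0" "\<gamma> < 2"
  shows "\<forall>\<^sub>F s in sequentially. \<forall>\<^sub>F p in sequentially. \<forall>r\<in>{s<..p}.
    real r + 3 * ln (real p) \<le> a * ((3/4) ^ r * sqrt (2 ^ p * ln (real p)))\<^sup>2 /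
      (2 ^ (p - r) + b * ((3/4) ^ r * sqrt (2 ^ p * ln (real p))) powr \<gamma>)"
proof -
  define \<delta> where "\<delta> = 1 - \<gamma> / 2"
  have "\<delta> > 0" using assms by (simp add: \<delta>_def)
  \<comment> \<open>Here 9/8 is 2 * (3/4)^2: at level \<open>r\<close> the squared threshold divided
    by the interval length \<open>2 ^ (p - r)\<close> is \<open>(9/8) ^ r * ln p\<close>. The factor
    2 reserves half of \<open>a * t\<^sup>2\<close> for each of the two terms of the
    denominator.\<close>
  have "\<forall>\<^sub>F r in sequentially. 2 * (real r + 3) / a \<le> (9/8) ^ r"
    using \<open>a > 0\<close> by real_asymp
  then obtain s0 where s0: "\<And>r. r \<ge> s0 \<Longrightarrow> 2 * (real r + 3) / a \<le> (9/8) ^ r"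
    by (auto simp: eventually_sequentially)
  have "\<forall>\<^sub>F p in sequentially. 2 * (real p + 3 * ln (real p)) * b / a \<le> ((9/8) ^ p) powr \<delta>"
    using \<open>\<delta> > 0\<close> \<open>a > 0\<close> by real_asymp
  moreover have "\<forall>\<^sub>F p in sequentially. 1 \<le> ln (real p)" by real_asymp
  moreover have "\<forall>\<^sub>F p in sequentially. (1::nat) \<le> p" by (rule eventually_ge_at_top)
  ultimately have *: "\<forall>\<^sub>F p in sequentially. \<forall>r\<in>{s<..p}.
    real r + 3 * ln (real p) \<le> a * ((3/4) ^ r * sqrt (2 ^ p * ln (real p)))\<^sup>2 /
      (2 ^ (p - r) + b * ((3/4) ^ r * sqrt (2 ^ p * ln (real p))) powr \<gamma>)" if "s \<ge> s0" for s
  proof eventually_elim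
    case (elim p)
    define L where "L = ln (real p)"
    have L: "L \<ge> 1" using elim by (simp add: L_def)
    show ?case
    proof
      fix r assume r: "r \<in> {s<..p}"
      define t where "t = (3/4) ^ r * sqrt (2 ^ p * L)"
      have "t > 0" using L by (simp add: t_def)
      have t2: "t\<^sup>2 = (9/16) ^ r * 2 ^ p * L"
      proof -
        have "((3/4::real) ^ r)\<^sup>2 = (9/16) ^ r"
          by (simp add: power2_eq_square flip: power_mult_distrib)
        then show ?thesis using L by (simp add: t_def power_mult_distrib)
      qed
      have "(2::real) ^ p = 2 ^ r * 2 ^ (p - r)"
        using r by (simp flip: power_add)
      then have t2': "t\<^sup>2 = (9/8) ^ r * L * 2 ^ (p - r)"
        unfolding t2 by (simp flip: power_mult_distrib)
      have "(2 * (real r + 3 * L)) \<le> a * ((9/8) ^ r * L)"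
      proof -
        have "2 * (real r + 3 * L) \<le> 2 * (real r + 3) * L"
          using L mult_left_mono[of 1 L "real r"] by (simp add: algebra_simps)
        also have "\<dots> \<le> (a * (9/8) ^ r) * L"
          using s0[of r] r that L \<open>a > 0\<close>
          by (intro mult_right_mono) (auto simp: field_simps)
        finally show ?thesis by simp
      qed
      then have "(2 * (real r + 3 * L)) * 2 ^ (p - r) \<le> a * ((9/8) ^ r * L) * 2 ^ (p - r)"
        by (rule mult_right_mono) simp
      then have 1: "(2 * (real r + 3 * L)) * 2 ^ (p - r) \<le> a * t\<^sup>2"
        by (simp add: t2')
      \<comment> \<open>The thresholds decrease in \<open>r\<close>, so the finest level
        \<open>r = p\<close> is the worst case for the term with \<open>b\<close>. This gives a
        bound uniform over all levels.\<close>
      have "(9/8) ^ p \<le> t\<^sup>2"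
      proof -
        have "(9/8::real) ^ p = (9/16) ^ p * 2 ^ p" by (simp flip: power_mult_distrib)
        also have "\<dots> \<le> (9/16) ^ r * 2 ^ p"
          using r by (intro mult_right_mono power_decreasing) auto
        also have "\<dots> \<le> (9/16) ^ r * 2 ^ p * L"
          using L by simp
        finally show ?thesis by (simp add: t2)
      qed
      then have "((9/8) ^ p) powr \<delta> \<le> (t\<^sup>2) powr \<delta>"
        using \<open>\<delta> > 0\<close> by (intro powr_mono2) auto
      moreover have "2 * (real r + 3 * L) * b \<le> 2 * (real p + 3 * L) * b"
        using r \<open>b \<ge> 0\<close> by (intro mult_right_mono) auto
      moreover have "2 * (real p + 3 * L) * b \<le> a * ((9/8) ^ p) powr \<delta>"
        using elim(1) \<open>a > 0\<close> by (simp add: L_def field_simps)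
      ultimately have "2 * (real r + 3 * L) * b \<le> a * (t\<^sup>2) powr \<delta>"
        using \<open>a > 0\<close> by (smt (verit) mult_left_mono)
      then have "2 * (real r + 3 * L) * b * t powr \<gamma> \<le> a * (t\<^sup>2) powr \<delta> * t powr \<gamma>"
        by (rule mult_right_mono) simp
      then have 2: "2 * (real r + 3 * L) * (b * t powr \<gamma>) \<le> a * t\<^sup>2"
        using powr_split_square[OF \<open>t > 0\<close>, of \<gamma>] by (simp add: \<delta>_def mult_ac)
      have "real r + 3 * L \<le> a * t\<^sup>2 / (2 ^ (p - r) + b * t powr \<gamma>)"
      proof (rule le_exponentI)
        show "(real r + 3 * L) * 2 ^ (p - r) + (real r + 3 * L) * (b * t powr \<gamma>) \<le> a * t\<^sup>2"
          using 1 2 unfolding mult.assoc by linarith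
      qed (use \<open>b \<ge> 0\<close> in simp_all)
      then show "real r + 3 * ln (real p) \<le> a * ((3/4) ^ r * sqrt (2 ^ p * ln (real p)))\<^sup>2 /
        (2 ^ (p - r) + b * ((3/4) ^ r * sqrt (2 ^ p * ln (real p))) powr \<gamma>)"
        by (simp add: t_def L_def)
    qed
  qed
  show ?thesis
    by (rule eventually_mono[OF eventually_ge_at_top[of s0]]) (rule *)
qed

text \<open>Without the term in \<open>b\<close> the quotient would be exactly
  \<open>a * c\<^sup>2 * ln p\<close>. The gap between \<open>d\<close> and
  \<open>a * c\<^sup>2\<close> absorbs that term, which is smaller than \<open>n\<close> by a
  positive power, up to a logarithm.\<close>

lemma eventually_exponent_grid:
  fixes a b c d \<gamma> :: real
  assumes "c > 0" "b \<ge> 0" "\<gamma> < 2" "0 < d" "d < a * c\<^sup>2"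
  shows "\<forall>\<^sub>F p in sequentially. \<forall>n \<ge> 2 ^ p.
    d * ln (real p) \<le> a * (c * sqrt (real n * ln (real p)))\<^sup>2 /
      (real n + b * (c * sqrt (real n * ln (real p))) powr \<gamma>)"
proof -
  define \<delta> where "\<delta> = 1 - \<gamma> / 2"
  define \<eta> where "\<eta> = a * c\<^sup>2 - d"
  have "\<delta> > 0" "\<eta> > 0" using assms by (simp_all add: \<delta>_def \<eta>_def)
  \<comment> \<open>The extra factor \<open>c\<^sup>2 * ln p\<close> anticipates
    \<open>t\<^sup>2 = c\<^sup>2 * n * ln p\<close>: multiplying by \<open>t powr \<gamma>\<close>
    turns the right-hand side into \<eta> times \<open>t\<^sup>2\<close>, and cancelling the factor
    leaves \<open>d * b * t powr \<gamma>\<close> at most \<eta> times \<open>n\<close>.\<close>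
  have "\<forall>\<^sub>F p in sequentially. d * b * (c\<^sup>2 * ln (real p)) / \<eta> \<le> (c\<^sup>2 * 2 ^ p) powr \<delta>"
    using \<open>\<delta> > 0\<close> \<open>\<eta> > 0\<close> \<open>c > 0\<close> by real_asymp
  moreover have "\<forall>\<^sub>F p in sequentially. 1 \<le> ln (real p)" by real_asymp
  ultimately show ?thesis
  proof eventually_elim
    case (elim p)
    define L where "L = ln (real p)"
    have L: "L \<ge> 1" using elim by (simp add: L_def)
    show ?case
    proof (intro allI impI)
      fix n :: nat assume n: "2 ^ p \<le> n"
      then have n': "2 ^ p \<le> real n" by (metis of_nat_le_iff of_nat_numeral of_nat_power)
      then have "real n > 0" by (smt (verit) zero_less_power)
      define t where "t = c * sqrt (real n * L)"
      have "t > 0" using L \<open>c > 0\<close> \<open>real n > 0\<close> by (simp add: t_def)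
      have t2: "t\<^sup>2 = c\<^sup>2 * real n * L"
        using L \<open>real n > 0\<close> by (simp add: t_def power_mult_distrib)
      have "c\<^sup>2 * 2 ^ p \<le> t\<^sup>2"
      proof -
        have "c\<^sup>2 * 2 ^ p * 1 \<le> c\<^sup>2 * real n * L"
          using n' L by (intro mult_mono) auto
        then show ?thesis by (simp add: t2)
      qed
      then have "(c\<^sup>2 * 2 ^ p) powr \<delta> \<le> (t\<^sup>2) powr \<delta>"
        using \<open>\<delta> > 0\<close> by (intro powr_mono2) auto
      moreover have "d * b * (c\<^sup>2 * L) \<le> \<eta> * (c\<^sup>2 * 2 ^ p) powr \<delta>"
        using elim(1) \<open>\<eta> > 0\<close> by (simp add: L_def field_simps)
      ultimately have "d * b * (c\<^sup>2 * L) \<le> \<eta> * (t\<^sup>2) powr \<delta>"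
        using \<open>\<eta> > 0\<close> by (smt (verit) mult_left_mono)
      then have "d * b * (c\<^sup>2 * L) * t powr \<gamma> \<le> \<eta> * (t\<^sup>2) powr \<delta> * t powr \<gamma>"
        by (rule mult_right_mono) simp
      then have "(c\<^sup>2 * L) * (d * b * t powr \<gamma>) \<le> (c\<^sup>2 * L) * (\<eta> * real n)"
        using powr_split_square[OF \<open>t > 0\<close>, of \<gamma>] t2 by (simp add: \<delta>_def mult_ac)
      moreover have "c\<^sup>2 * L > 0" using L \<open>c > 0\<close> by simp
      ultimately have "d * b * t powr \<gamma> \<le> \<eta> * real n"
        by (metis mult_le_cancel_left_pos)
      then have "L * (d * b * t powr \<gamma>) \<le> L * (\<eta> * real n)"
        using L by (intro mult_left_mono) auto
      then have "d * L * real n + d * L * (b * t powr \<gamma>) \<le> a * t\<^sup>2"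
        unfolding t2 \<eta>_def by (simp add: algebra_simps)
      then have "d * L \<le> a * t\<^sup>2 / (real n + b * t powr \<gamma>)"
        using \<open>real n > 0\<close> \<open>b \<ge> 0\<close> by (intro le_exponentI) auto
      then show "d * ln (real p) \<le> a * (c * sqrt (real n * ln (real p)))\<^sup>2 /
        (real n + b * (c * sqrt (real n * ln (real p))) powr \<gamma>)"
        by (simp add: t_def L_def)
    qed
  qed
qed

section \<open>Borel--Cantelli over the dyadic blocks\<close>

lemma sum_geometric_tail_le:
  "(\<Sum>r\<in>{s<..p}. (3/4::real) ^ r) \<le> 4 * (3/4) ^ s"
proof (cases "s \<le> p")
  case True
  then have "(\<Sum>r\<in>{s<..p}. (3/4::real) ^ r) = 3 * (3/4) ^ s - 3 * (3/4) ^ p"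
  proof (induction p rule: dec_induct)
    case (step p)
    then have "{s<..Suc p} = insert (Suc p) {s<..p}" by auto
    with step show ?case by simp
  qed simp
  moreover have "(3/4::real) ^ s > 0" "(3/4::real) ^ p > 0" by simp_all
  ultimately show ?thesis by linarith
qed simp

text \<open>The value at a grid point costs \<open>c\<close>, and the chain from there to
  \<open>2 ^ p + k\<close> costs \<open>e\<close>. The condition \<open>1 < a * c\<^sup>2\<close>
  makes the grid probabilities summable; \<open>e\<close> may be arbitrarily small because the grid
  depth \<open>s\<close> is chosen depending on it.\<close>

lemma AE_eventually_dyadic_bound:
  fixes M :: "'a measure" and S :: "nat \<Rightarrow> 'a \<Rightarrow> real" and A a b c e \<gamma> :: real
  assumes "prob_space M"
    and S_measurable[measurable]: "\<And>n. S n \<in> borel_measurable M"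
    and S_0: "\<And>\<omega>. S 0 \<omega> = 0"
    and "A > 0" "a > 0" "b \<ge> 0" "\<gamma> < 2"
    and tail: "\<And>m n t. n \<ge> 1 \<Longrightarrow> t \<ge> 0 \<Longrightarrow>
      measure M {\<omega> \<in> space M. \<bar>S (m + n) \<omega> - S m \<omega>\<bar> > t}
        \<le> A * exp (- (a * t\<^sup>2 / (real n + b * t powr \<gamma>)))"
    and "c > 0" "1 < a * c\<^sup>2" "e > 0"
  shows "AE \<omega> in M. \<forall>\<^sub>F p in sequentially. \<forall>k < 2 ^ p.
    \<bar>S (2 ^ p + k) \<omega>\<bar> \<le> (c + e) * sqrt (real (2 ^ p + k) * ln (real p))"
proof -
  interpret prob_space M by fact
  have "\<forall>\<^sub>F s in sequentially. 4 * (3/4) ^ s \<le> e"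
    using \<open>e > 0\<close> by real_asymp
  with eventually_exponent_levels[OF \<open>a > 0\<close> \<open>b \<ge> 0\<close> \<open>\<gamma> < 2\<close>]
  have "\<forall>\<^sub>F s in sequentially. 4 * (3/4) ^ s \<le> e \<and>
    (\<forall>\<^sub>F p in sequentially. \<forall>r\<in>{s<..p}.
      real r + 3 * ln (real p) \<le> a * ((3/4) ^ r * sqrt (2 ^ p * ln (real p)))\<^sup>2 /
        (2 ^ (p - r) + b * ((3/4) ^ r * sqrt (2 ^ p * ln (real p))) powr \<gamma>))"
    by eventually_elim auto
  then obtain s where s: "4 * (3/4) ^ s \<le> e"
    and levels: "\<forall>\<^sub>F p in sequentially. \<forall>r\<in>{s<..p}.
      real r + 3 * ln (real p) \<le> a * ((3/4) ^ r * sqrt (2 ^ p * ln (real p)))\<^sup>2 /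
        (2 ^ (p - r) + b * ((3/4) ^ r * sqrt (2 ^ p * ln (real p))) powr \<gamma>)"
    by (auto dest: eventually_happens)
  obtain d where d: "1 < d" "d < a * c\<^sup>2" using dense \<open>1 < a * c\<^sup>2\<close> by blast
  define u where "u p r = (3/4) ^ r * sqrt (2 ^ p * ln (real p))" for p r :: nat
  \<comment> \<open>The grid threshold scales with the actual index \<open>n\<close>; using
    \<open>2 ^ (p + 1)\<close> instead would lose a factor of up to \<open>sqrt 2\<close> in the
    leading constant. For the chain thresholds \<open>u\<close> the cruder \<open>2 ^ p\<close>
    suffices.\<close>
  define v where "v p n = c * sqrt (real n * ln (real p))" for p n :: nat
  define G where "G p i = {\<omega> \<in> space M.
    \<bar>S (2 ^ p + i * 2 ^ (p - s)) \<omega>\<bar> > v p (2 ^ p + i * 2 ^ (p - s))}" for p i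
  define D where "D p r j = {\<omega> \<in> space M.
    \<bar>S (2 ^ p + (j * 2 ^ (p - r) + 2 ^ (p - r))) \<omega> - S (2 ^ p + j * 2 ^ (p - r)) \<omega>\<bar> > u p r}"
    for p r j
  define E where "E p = (\<Union>i<2 ^ s. G p i) \<union> (\<Union>r\<in>{s<..p}. \<Union>j<2 ^ r. D p r j)" for p
  have G[measurable]: "G p i \<in> sets M" for p i unfolding G_def by measurable
  have D[measurable]: "D p r j \<in> sets M" for p r j unfolding D_def by measurable
  have E[measurable]: "E p \<in> sets M" for p unfolding E_def by measurable
  have exp_ln: "exp (- (x * ln (real p))) = real p powr - x" if "p \<ge> 1" for x p
    using that by (simp add: powr_def)
  have "\<forall>\<^sub>F p in sequentially. prob (E p) \<le> 2 ^ s * A * real p powr - d + A * real p powr - 2"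
    using levels eventually_exponent_grid[OF \<open>c > 0\<close> \<open>b \<ge> 0\<close> \<open>\<gamma> < 2\<close> order.strict_trans[OF zero_less_one d(1)] d(2)]
      eventually_ge_at_top[of 1]
  proof eventually_elim
    case (elim p)
    have "prob (G p i) \<le> A * real p powr - d" for i
    proof -
      define n where "n = (2::nat) ^ p + i * 2 ^ (p - s)"
      have n: "n \<ge> 2 ^ p" by (simp add: n_def)
      then have "n \<ge> 1" using one_le_power[of "2::nat" p] by linarith
      \<comment> \<open>A single value of \<open>S\<close> is its increment from
        \<open>m = 0\<close>, since \<open>S 0\<close> vanishes.\<close>
      have "prob (G p i) \<le> A * exp (- (a * (v p n)\<^sup>2 / (real n + b * v p n powr \<gamma>)))"
        using tail[of n "v p n" 0] \<open>n \<ge> 1\<close> \<open>c > 0\<close> \<open>1 \<le> p\<close>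
        by (simp add: G_def S_0 v_def flip: n_def)
      also have "\<dots> \<le> A * exp (- (d * ln (real p)))"
        using elim n d \<open>A > 0\<close> by (auto simp: v_def)
      finally show ?thesis using exp_ln \<open>1 \<le> p\<close> by simp
    qed
    then have "(\<Sum>i<2 ^ s. prob (G p i)) \<le> 2 ^ s * (A * real p powr - d)"
      using sum_bounded_above[of "{..<2 ^ s}" "\<lambda>i. prob (G p i)"] by simp
    then have 1: "prob (\<Union>i<2 ^ s. G p i) \<le> 2 ^ s * (A * real p powr - d)"
      by (intro order_trans[OF finite_measure_subadditive_finite]) auto
    have 2: "prob (\<Union>j<2 ^ r. D p r j) \<le> A * real p powr - 3" if r: "r \<in> {s<..p}" for r
    proof -
      have "prob (D p r j) \<le> A * (exp (- real r) * real p powr - 3)" for j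
      proof -
        have "prob (D p r j) \<le> A * exp (- (a * (u p r)\<^sup>2 / (2 ^ (p - r) + b * u p r powr \<gamma>)))"
          using tail[of "2 ^ (p - r)" "u p r" "2 ^ p + j * 2 ^ (p - r)"] \<open>1 \<le> p\<close>
          by (simp add: D_def u_def add.assoc)
        also have "\<dots> \<le> A * exp (- real r - 3 * ln (real p))"
          using elim(1) r \<open>A > 0\<close> by (fastforce simp: u_def)
        also have "\<dots> = A * (exp (- real r) * exp (- (3 * ln (real p))))"
          by (simp flip: exp_add)
        finally show ?thesis using exp_ln \<open>1 \<le> p\<close> by simp
      qed
      then have "(\<Sum>j<2 ^ r. prob (D p r j)) \<le> 2 ^ r * (A * (exp (- real r) * real p powr - 3))"
        using sum_bounded_above[of "{..<2 ^ r}" "\<lambda>j. prob (D p r j)"] by simp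
      also have "\<dots> = 2 ^ r * exp (- real r) * (A * real p powr - 3)" by simp
      \<comment> \<open>The union bound over \<open>2 ^ r\<close> intervals is paid for by
        \<open>exp (- r)\<close>, because 2 is at most \<open>exp 1\<close>.\<close>
      also have "\<dots> \<le> 1 * (A * real p powr - 3)"
      proof (rule mult_right_mono)
        have "(2::real) ^ r \<le> exp 1 ^ r"
          using exp_ge_add_one_self[of 1] by (intro power_mono) auto
        then show "2 ^ r * exp (- real r) \<le> 1"
          using exp_of_nat_mult[of r "1::real"] by (simp add: exp_minus divide_simps)
      qed (use \<open>A > 0\<close> in simp)
      finally show ?thesis
        by (intro order_trans[OF finite_measure_subadditive_finite]) auto
    qed
    have "prob (\<Union>r\<in>{s<..p}. \<Union>j<2 ^ r. D p r j) \<le> (\<Sum>r\<in>{s<..p}. prob (\<Union>j<2 ^ r. D p r j))"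
      by (rule finite_measure_subadditive_finite) auto
    also have "\<dots> \<le> (\<Sum>r\<in>{s<..p}. A * real p powr - 3)"
      using 2 by (rule sum_mono)
    also have "\<dots> \<le> real p * (A * real p powr - 3)"
      using \<open>A > 0\<close> by (simp add: mult_right_mono)
    also have "\<dots> = A * real p powr - 2"
      using \<open>1 \<le> p\<close> powr_add[of "real p" 1 "- 3"] by simp
    finally have "prob (\<Union>r\<in>{s<..p}. \<Union>j<2 ^ r. D p r j) \<le> A * real p powr - 2" .
    moreover have "prob (E p) \<le> prob (\<Union>i<2 ^ s. G p i) + prob (\<Union>r\<in>{s<..p}. \<Union>j<2 ^ r. D p r j)"
      unfolding E_def by (rule measure_Un_le) auto
    ultimately show ?case using 1 by simp
  qed
  then have "summable (\<lambda>p. prob (E p))"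
  proof (rule summable_comparison_test_ev[OF eventually_mono])
    show "summable (\<lambda>p. 2 ^ s * A * real p powr - d + A * real p powr - 2)"
      using d by (intro summable_add summable_mult) (auto simp: summable_real_powr_iff)
  qed simp
  then have "AE \<omega> in M. \<forall>\<^sub>F p in sequentially. \<omega> \<in> space M - E p"
    by (intro borel_cantelli_AE1) (auto simp: emeasure_eq_measure)
  then show ?thesis
  proof eventually_elim
    case (elim \<omega>)
    from elim eventually_ge_at_top[of "max s 1"] show ?case
    proof eventually_elim
      case (elim p)
      have "s \<le> p" "1 \<le> p" using elim by auto
      have L: "ln (real p) \<ge> 0" using \<open>1 \<le> p\<close> by simp
      show ?case
      proof (intro allI impI)
        fix k :: nat assume "k < 2 ^ p"
        define R where "R = sqrt (real (2 ^ p + k) * ln (real p))"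
        define f where "f l = S (2 ^ p + l) \<omega>" for l
        have "\<bar>f (j * 2 ^ (p - r) + 2 ^ (p - r)) - f (j * 2 ^ (p - r))\<bar> \<le> u p r"
          if "s < r" "r \<le> p" "j < 2 ^ r" for r j
        proof -
          have "\<omega> \<notin> D p r j" using elim(1) that by (auto simp: E_def)
          then show ?thesis using elim(1) by (simp add: D_def f_def not_less)
        qed
        then obtain i where i: "i < 2 ^ s" "i * 2 ^ (p - s) \<le> k"
          "\<bar>f k - f (i * 2 ^ (p - s))\<bar> \<le> (\<Sum>r\<in>{s<..p}. u p r)"
          by (rule dyadic_chain[OF _ \<open>s \<le> p\<close> \<open>k < 2 ^ p\<close>])
        have "\<omega> \<notin> G p i" using elim(1) i(1) by (auto simp: E_def)
        then have "\<bar>f (i * 2 ^ (p - s))\<bar> \<le> v p (2 ^ p + i * 2 ^ (p - s))"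
          using elim(1) by (simp add: G_def f_def not_less)
        also have "\<dots> \<le> c * R"
          unfolding v_def R_def using \<open>c > 0\<close> L i(2)
          by (intro mult_left_mono real_sqrt_le_mono mult_right_mono of_nat_mono) auto
        finally have 1: "\<bar>f (i * 2 ^ (p - s))\<bar> \<le> c * R" .
        have "(\<Sum>r\<in>{s<..p}. u p r) = (\<Sum>r\<in>{s<..p}. (3/4) ^ r) * sqrt (2 ^ p * ln (real p))"
          by (simp add: u_def sum_distrib_right)
        also have "\<dots> \<le> e * R"
          unfolding R_def using L s sum_geometric_tail_le[of s p] \<open>e > 0\<close>
          by (intro mult_mono real_sqrt_le_mono mult_right_mono) auto
        finally have "\<bar>f k\<bar> \<le> (c + e) * R"
          using 1 i(3) by (simp add: distrib_right)
        then show "\<bar>S (2 ^ p + k) \<omega>\<bar> \<le> (c + e) * sqrt (real (2 ^ p + k) * ln (real p))"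
          by (simp add: f_def R_def)
      qed
    qed
  qed
qed

section \<open>From \<open>ln p\<close> to the iterated logarithm\<close>

text \<open>If \<open>2 ^ p \<le> n\<close>, then \<open>p\<close> is at most
  \<open>ln n / ln 2\<close>, and the logarithm of this is asymptotic to \<open>ln (ln n)\<close>.
  The strict gap \<open>K < C\<close> absorbs the ratio.\<close>

lemma eventually_loglog_of_dyadic:
  fixes f :: "nat \<Rightarrow> real"
  assumes dyadic: "\<forall>\<^sub>F p in sequentially. \<forall>k < 2 ^ p.
      f (2 ^ p + k) \<le> K * sqrt (real (2 ^ p + k) * ln (real p))"
    and "0 < K" "K < C"
  shows "\<forall>\<^sub>F n in sequentially. f n / sqrt (real n * ln (ln (real n))) \<le> C"
proof -
  obtain p0 where p0: "\<And>p k. p \<ge> p0 \<Longrightarrow> k < 2 ^ p \<Longrightarrow>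
      f (2 ^ p + k) \<le> K * sqrt (real (2 ^ p + k) * ln (real p))"
    using dyadic by (auto simp: eventually_sequentially)
  have "(\<lambda>n::nat. ln (ln (real n) / ln 2) / ln (ln (real n))) \<longlonglongrightarrow> 1"
    by real_asymp
  moreover have "1 < (C / K)\<^sup>2"
    using \<open>0 < K\<close> \<open>K < C\<close> by (simp add: one_less_power)
  ultimately have "\<forall>\<^sub>F n in sequentially. ln (ln (real n) / ln 2) / ln (ln (real n)) < (C / K)\<^sup>2"
    by (rule order_tendstoD)
  moreover have "\<forall>\<^sub>F n in sequentially. 0 < ln (ln (real n))" by real_asymp
  \<comment> \<open>The successor gives \<open>p \<ge> Suc p0\<close>, so \<open>p\<close> is also
    positive, as monotonicity of \<open>ln\<close> requires.\<close>
  moreover have "\<forall>\<^sub>F n in sequentially. 2 ^ Suc p0 \<le> n" by (rule eventually_ge_at_top)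
  ultimately show ?thesis
  proof eventually_elim
    case (elim n)
    have "n > 0" using elim(3) by (metis gr0I le_zero_eq power_not_zero zero_neq_numeral)
    then obtain p where p: "2 ^ p \<le> n" "n < 2 ^ Suc p"
      using ex_power_ivl1[of 2 n] by auto
    have "p \<ge> Suc p0"
      using p(2) elim(3) by (meson le_less_trans less_Suc_eq_le one_less_numeral_iff power_less_imp_less_exp semiring_norm(76))
    define k where "k = n - 2 ^ p"
    have k: "n = 2 ^ p + k" "k < 2 ^ p" using p by (auto simp: k_def)
    have "real (2 ^ p) \<le> real n" using p(1) by (rule of_nat_mono)
    then have "ln (2 ^ p) \<le> ln (real n)" using \<open>n > 0\<close> by (subst ln_le_cancel_iff) auto
    then have "real p \<le> ln (real n) / ln 2"
      by (simp add: ln_realpow field_simps)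
    then have "ln (real p) \<le> ln (ln (real n) / ln 2)"
      using \<open>p \<ge> Suc p0\<close> by (intro ln_mono) auto
    also have "\<dots> \<le> (C / K)\<^sup>2 * ln (ln (real n))"
      using elim(1,2) by (simp add: field_simps)
    finally have "real n * ln (real p) \<le> real n * ((C / K)\<^sup>2 * ln (ln (real n)))"
      by (intro mult_left_mono) auto
    also have "\<dots> = (C / K)\<^sup>2 * (real n * ln (ln (real n)))" by simp
    finally have "sqrt (real n * ln (real p)) \<le> sqrt ((C / K)\<^sup>2 * (real n * ln (ln (real n))))"
      by (rule real_sqrt_le_mono)
    also have "\<dots> = C / K * sqrt (real n * ln (ln (real n)))"
      using \<open>0 < K\<close> \<open>K < C\<close> unfolding real_sqrt_mult[of "(C / K)\<^sup>2"] by simp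
    finally have "sqrt (real n * ln (real p)) \<le> C / K * sqrt (real n * ln (ln (real n)))" .
    then have "K * sqrt (real n * ln (real p)) \<le> C * sqrt (real n * ln (ln (real n)))"
      using \<open>0 < K\<close> by (simp add: field_simps)
    then have "f n \<le> C * sqrt (real n * ln (ln (real n)))"
      using p0[of p k] k \<open>p \<ge> Suc p0\<close> by simp
    then show ?case
      using elim(2) \<open>n > 0\<close> by (simp add: pos_divide_le_eq)
  qed
qed

section \<open>Letting the constant decrease to \<open>1 / sqrt a\<close>\<close>

theorem corollary1:
  fixes M :: "'a measure" and X :: "nat \<Rightarrow> 'a \<Rightarrow> real" and A a b \<gamma> :: real
  assumes "prob_space M"
    and "\<And>i. i \<ge> 1 \<Longrightarrow> X i \<in> borel_measurable M"
    and "A > 0" and "a > 0" and "b \<ge> 0" and "0 < \<gamma>" and "\<gamma> < 2"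
    and "\<And>(m::nat) (n::nat) (t::real). n \<ge> 1 \<Longrightarrow> t \<ge> 0 \<Longrightarrow>
      measure M {\<omega> \<in> space M. \<bar>partial_sum X (m + 1) (m + n) \<omega>\<bar> > t}
        \<le> A * exp (- (a * t\<^sup>2 / (real n + b * t powr \<gamma>)))"
  shows "AE \<omega> in M.
    limsup (\<lambda>n. ereal (\<bar>partial_sum X 1 n \<omega>\<bar> / sqrt (real n * ln (ln (real n)))))
      \<le> ereal (1 / sqrt a)"
proof -
  have diff: "partial_sum X 1 (m + n) \<omega> - partial_sum X 1 m \<omega> = partial_sum X (m + 1) (m + n) \<omega>"
    for m n \<omega>
    unfolding partial_sum_def using sum.ub_add_nat[of 1 m "\<lambda>i. X i \<omega>" n] by simp
  \<comment> \<open>The excess runs through a sequence because only countably many null sets can be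
    discarded together.\<close>
  have "AE \<omega> in M. limsup (\<lambda>n. ereal (\<bar>partial_sum X 1 n \<omega>\<bar> / sqrt (real n * ln (ln (real n)))))
      \<le> ereal (1 / sqrt a + 1 / real (Suc N))" for N
  proof -
    \<comment> \<open>Of three equal shares of the excess, one raises \<open>c\<close> above
      \<open>1 / sqrt a\<close>, one pays for the chain, and one keeps the final comparison of
      constants strict.\<close>
    define h where "h = 1 / (3 * real (Suc N))"
    have "h > 0" by (simp add: h_def)
    have "0 < 1 / sqrt a" using \<open>a > 0\<close> by simp
    with \<open>h > 0\<close> have "0 < 1 / sqrt a + h" by (rule add_pos_pos[rotated])
    have "1 = a * (1 / sqrt a)\<^sup>2" using \<open>a > 0\<close> by (simp add: power_divide)
    also have "\<dots> < a * (1 / sqrt a + h)\<^sup>2"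
      using \<open>a > 0\<close> \<open>h > 0\<close> by (intro mult_strict_left_mono power_strict_mono) auto
    finally have "1 < a * (1 / sqrt a + h)\<^sup>2" .
    have "AE \<omega> in M. \<forall>\<^sub>F p in sequentially. \<forall>k < 2 ^ p.
      \<bar>partial_sum X 1 (2 ^ p + k) \<omega>\<bar>
        \<le> ((1 / sqrt a + h) + h) * sqrt (real (2 ^ p + k) * ln (real p))"
    proof (rule AE_eventually_dyadic_bound[OF assms(1) _ _ assms(3-5,7)])
      show "partial_sum X 1 n \<in> borel_measurable M" for n
        unfolding partial_sum_def using assms(2) by (intro borel_measurable_sum) auto
      show "partial_sum X 1 0 \<omega> = 0" for \<omega> by (simp add: partial_sum_def)
      show "measure M {\<omega> \<in> space M. \<bar>partial_sum X 1 (m + n) \<omega> - partial_sum X 1 m \<omega>\<bar> > t}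
        \<le> A * exp (- (a * t\<^sup>2 / (real n + b * t powr \<gamma>)))" if "n \<ge> 1" "t \<ge> 0" for m n t
        unfolding diff using assms(8) that by blast
    qed (use \<open>h > 0\<close> \<open>0 < 1 / sqrt a + h\<close> \<open>1 < a * (1 / sqrt a + h)\<^sup>2\<close> in auto)
    then show ?thesis
    proof eventually_elim
      case (elim \<omega>)
      have "1 / real (Suc N) = 3 * h" by (simp add: h_def field_simps)
      with \<open>h > 0\<close> have "(1 / sqrt a + h) + h < 1 / sqrt a + 1 / real (Suc N)" by linarith
      from eventually_loglog_of_dyadic[OF elim _ this] \<open>h > 0\<close> \<open>0 < 1 / sqrt a\<close>
      show ?case by (intro Limsup_bounded) simp
    qed
  qed
  then have "AE \<omega> in M. \<forall>N.
      limsup (\<lambda>n. ereal (\<bar>partial_sum X 1 n \<omega>\<bar> / sqrt (real n * ln (ln (real n)))))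
        \<le> ereal (1 / sqrt a + 1 / real (Suc N))"
    by (simp add: AE_all_countable)
  then show ?thesis
  proof eventually_elim
    case (elim \<omega>)
    have "(\<lambda>N. ereal (1 / sqrt a + 1 / real (Suc N))) \<longlonglongrightarrow> ereal (1 / sqrt a)"
      using LIMSEQ_inverse_real_of_nat_add[of "1 / sqrt a"]
      by (intro tendsto_ereal) (simp add: inverse_eq_divide)
    then show ?case
      by (rule LIMSEQ_le_const) (use elim in blast)
  qed
qed

end
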